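(* Let $\alpha,\beta\in\mathbb{C}$ be nonzero with $|\alpha|^2+|\beta|^2=1$. Then the operator $S_{\alpha,\beta}$ on $H^2_{\alpha,\beta}$ is hyponormal, i.e. $S_{\alpha,\beta}^*S_{\alpha,\beta}-S_{\alpha,\beta}S_{\alpha,\beta}^*\ge 0$.
   Context: $H^2(\mathbb{D})$ is the Hardy space of the open unit disc. Let $H^2_{\alpha,\beta}=\overline{\mathrm{span}}\{\alpha+\beta z,\ z^n: n\ge 2\}$, a closed subspace of $H^2(\mathbb{D})$. Let $P_{H^2_{\alpha,\beta}}$ be the orthogonal projection of $H^2(\mathbb{D})$ onto $H^2_{\alpha,\beta}$, $M_z$ multiplication by $z$ on $H^2(\mathbb{D})$, and $S_{\alpha,\beta}=P_{H^2_{\alpha,\beta}}M_z|_{H^2_{\alpha,\beta}}$. *)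

theory Defs
  imports "HOL-Complex_Analysis.Complex_Analysis" "HOL-Library.Function_Algebras"
begin

text \<open>
  Functions on the open unit disc are total functions \<^typ>\<open>complex \<Rightarrow> complex\<close> that vanish off the
  disc, so that equality of elements is equality of functions on the disc.
\<close>

definition on_disc :: "(complex \<Rightarrow> complex) \<Rightarrow> complex \<Rightarrow> complex" where
  "on_disc f z = (if z \<in> ball 0 1 then f z else 0)"

definition taylor_coeff :: "(complex \<Rightarrow> complex) \<Rightarrow> nat \<Rightarrow> complex" where
  "taylor_coeff f n = fps_nth (fps_expansion f 0) n"

definition hardy2 :: "(complex \<Rightarrow> complex) set" where
  "hardy2 = {f. f holomorphic_on ball 0 1 \<and> (\<forall>z. z \<notin> ball 0 1 \<longrightarrow> f z = 0) \<and>
                summable (\<lambda>n. (norm (taylor_coeff f n))\<^sup>2)}"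

definition h2_inner :: "(complex \<Rightarrow> complex) \<Rightarrow> (complex \<Rightarrow> complex) \<Rightarrow> complex" where
  "h2_inner f g = (\<Sum>n. taylor_coeff f n * cnj (taylor_coeff g n))"

definition h2_norm :: "(complex \<Rightarrow> complex) \<Rightarrow> real" where
  "h2_norm f = sqrt (Re (h2_inner f f))"

global_interpretation cfun: vector_space "\<lambda>(c::complex) (f::complex \<Rightarrow> complex) z. c * f z"
  by unfold_locales (auto simp: algebra_simps fun_eq_iff)

definition h2_closed_span :: "(complex \<Rightarrow> complex) set \<Rightarrow> (complex \<Rightarrow> complex) set" where
  "h2_closed_span B = {f \<in> hardy2. \<forall>\<epsilon>>0. \<exists>g \<in> cfun.span B. h2_norm (f - g) < \<epsilon>}"

text \<open>
  In the next two definitions \<open>M\<close> is a closed subspace of \<^const>\<open>hardy2\<close>; existence and uniqueness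
  of the described element are the projection theorem and, for bounded linear \<open>T : M \<rightarrow> M\<close>,
  the Riesz representation theorem. Operators on \<open>M\<close> are only meaningful on arguments in \<open>M\<close>.
\<close>

definition h2_proj :: "(complex \<Rightarrow> complex) set \<Rightarrow> (complex \<Rightarrow> complex) \<Rightarrow> (complex \<Rightarrow> complex)" where
  "h2_proj M f = (THE g. g \<in> M \<and> (\<forall>h\<in>M. h2_inner (f - g) h = 0))"

definition h2_adjoint_on :: "(complex \<Rightarrow> complex) set \<Rightarrow>
    ((complex \<Rightarrow> complex) \<Rightarrow> (complex \<Rightarrow> complex)) \<Rightarrow> (complex \<Rightarrow> complex) \<Rightarrow> (complex \<Rightarrow> complex)" where
  "h2_adjoint_on M T g = (THE h. h \<in> M \<and> (\<forall>f\<in>M. h2_inner (T f) g = h2_inner f h))"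

definition h2_positive_on :: "(complex \<Rightarrow> complex) set \<Rightarrow>
    ((complex \<Rightarrow> complex) \<Rightarrow> (complex \<Rightarrow> complex)) \<Rightarrow> bool" where
  "h2_positive_on M A \<longleftrightarrow> (\<forall>f\<in>M. h2_inner (A f) f \<in> \<real>\<^sub>\<ge>\<^sub>0)"

definition h2_hyponormal_on :: "(complex \<Rightarrow> complex) set \<Rightarrow>
    ((complex \<Rightarrow> complex) \<Rightarrow> (complex \<Rightarrow> complex)) \<Rightarrow> bool" where
  "h2_hyponormal_on M T \<longleftrightarrow>
     h2_positive_on M (\<lambda>f. h2_adjoint_on M T (T f) - T (h2_adjoint_on M T f))"

definition mult_z :: "(complex \<Rightarrow> complex) \<Rightarrow> (complex \<Rightarrow> complex)" where
  "mult_z f = (\<lambda>z. z * f z)"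

definition H2_ab :: "complex \<Rightarrow> complex \<Rightarrow> (complex \<Rightarrow> complex) set" where
  "H2_ab \<alpha> \<beta> = h2_closed_span
     (insert (on_disc (\<lambda>z. \<alpha> + \<beta> * z)) {on_disc (\<lambda>z. z ^ n) |n. n \<ge> 2})"

definition S_ab :: "complex \<Rightarrow> complex \<Rightarrow> (complex \<Rightarrow> complex) \<Rightarrow> (complex \<Rightarrow> complex)" where
  "S_ab \<alpha> \<beta> f = h2_proj (H2_ab \<alpha> \<beta>) (mult_z f)"

end

theory Submission
  imports Defs
begin

text \<open>
  The vectors \<open>e\<^sub>0 = \<alpha> + \<beta> z\<close> and \<open>e\<^sub>n = z\<^sup>n\<^sup>+\<^sup>1\<close> for \<open>n \<ge> 1\<close> form an orthonormal basis of
  the subspace, and in it the compressed shift \<open>S\<close> is nearly the unilateral shift: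
  \<open>S e\<^sub>0 = \<alpha> cnj(\<beta>) e\<^sub>0 + \<beta> e\<^sub>1\<close> and \<open>S e\<^sub>n = e\<^sub>n\<^sub>+\<^sub>1\<close> for \<open>n \<ge> 1\<close>. Hence
  \<open>S* e\<^sub>0 = cnj(\<alpha>) \<beta> e\<^sub>0\<close>, \<open>S* e\<^sub>1 = cnj(\<beta>) e\<^sub>0\<close> and \<open>S* e\<^sub>n\<^sub>+\<^sub>1 = e\<^sub>n\<close> for \<open>n \<ge> 1\<close>
  (lemmas \<open>S_ab_coords\<close> and \<open>S_ab_adjoint_coords\<close>).

  For \<open>f\<close> with coordinates \<open>a, b, \<dots>\<close> along \<open>e\<^sub>0, e\<^sub>1, \<dots>\<close>, the self-commutator form is the difference of
  the squared norms of \<open>S f\<close> and \<open>S* f\<close>. Beyond the first two coordinates the contributions cancel,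
  leaving
  \<open>|\<alpha> \<beta> a|\<^sup>2 + |\<beta> a|\<^sup>2 + |b|\<^sup>2 - |cnj(\<alpha>) \<beta> a + cnj(\<beta>) b|\<^sup>2\<close>.
  With \<open>s, t, x, y\<close> the moduli of \<open>\<alpha>, \<beta>, a, b\<close> and \<open>s\<^sup>2 + t\<^sup>2 = 1\<close>, this is at least
  \<open>(t x - s y)\<^sup>2 + 2 s t x y (1 - t) \<ge> 0\<close> (lemma \<open>self_commutator_form_nonneg\<close>).

  The projection and the adjoint are definite descriptions, so each is evaluated by exhibiting an
  element with the defining property. Such elements are built from square-summable
  coefficient sequences (\<open>hardy2_of_coeffs\<close>), and membership in the closed span becomes the single
  linear condition \<open>\<beta> f\<^sub>0 = \<alpha> f\<^sub>1\<close> on the first two coefficients (\<open>H2_ab_iff\<close>).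
\<close>

section \<open>Functions in the Hardy space and their coefficients\<close>

lemma taylor_coeff_eqI:
  assumes "f has_fps_expansion F"
  shows "taylor_coeff f n = fps_nth F n"
  using fps_nth_fps_expansion[OF assms] by (simp add: taylor_coeff_def fps_expansion_def)

lemma hardy2_has_fps_expansion:
  assumes "f \<in> hardy2"
  shows "f has_fps_expansion fps_expansion f 0"
  using assms by (intro has_fps_expansion_fps_expansion[of "ball 0 1"]) (auto simp: hardy2_def)

lemma hardy2_summable:
  assumes "f \<in> hardy2"
  shows "summable (\<lambda>n. (norm (taylor_coeff f n))\<^sup>2)"
  using assms by (simp add: hardy2_def)

lemma hardy2_eqI:
  assumes f: "f \<in> hardy2" and g: "g \<in> hardy2"
    and eq: "\<And>n. taylor_coeff f n = taylor_coeff g n"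
  shows "f = g"
proof
  fix z
  show "f z = g z"
  proof (cases "z \<in> ball 0 1")
    case True
    have "(\<lambda>n. taylor_coeff f n * z ^ n) sums f z" "(\<lambda>n. taylor_coeff g n * z ^ n) sums g z"
      using f g True holomorphic_power_series[of f 0 1 z] holomorphic_power_series[of g 0 1 z]
      by (simp_all add: hardy2_def taylor_coeff_def fps_expansion_def)
    then show ?thesis
      using eq sums_unique2 by auto
  next
    case False
    then show ?thesis
      using f g by (simp add: hardy2_def)
  qed
qed

lemma has_fps_expansion_on_disc:
  assumes "f has_fps_expansion F"
  shows "on_disc f has_fps_expansion F"
proof -
  have "eventually (\<lambda>z. z \<in> ball 0 1) (nhds (0::complex))"
    by (intro eventually_nhds_in_open) auto
  then have "eventually (\<lambda>z. on_disc f z = f z) (nhds 0)"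
    by eventually_elim (simp add: on_disc_def)
  then show ?thesis
    using assms by (simp add: has_fps_expansion_cong)
qed

lemma on_disc_holomorphic:
  assumes "f holomorphic_on ball 0 1"
  shows "on_disc f holomorphic_on ball 0 1"
  using assms by (rule holomorphic_transform) (simp add: on_disc_def)

text \<open>
  Square-summable coefficients are bounded, so their power series converges on the whole disc;
  this is what lets the operators below be prescribed by their action on coefficients.
\<close>
lemma hardy2_of_coeffs:
  fixes a :: "nat \<Rightarrow> complex"
  assumes "summable (\<lambda>n. (norm (a n))\<^sup>2)"
  obtains f where "f \<in> hardy2" and "\<And>n. taylor_coeff f n = a n"
proof -
  have "(\<lambda>n. (norm (a n))\<^sup>2) \<longlonglongrightarrow> 0"
    using assms by (rule summable_LIMSEQ_zero)
  then have "Bseq (\<lambda>n. (norm (a n))\<^sup>2)"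
    by (intro convergent_imp_Bseq convergentI)
  then obtain K where K: "\<And>n. (norm (a n))\<^sup>2 \<le> K" "K > 0"
    by (auto simp: Bseq_def)
  have aK: "norm (a n) \<le> sqrt K" for n
    using K(1)[of n] by (intro real_le_rsqrt)
  have "summable (\<lambda>n. a n * complex_of_real r ^ n)" if "0 < r" "ereal r < 1" for r
  proof (rule summable_comparison_test')
    show "summable (\<lambda>n. sqrt K * r ^ n)"
      using that by (intro summable_mult summable_geometric) auto
    show "norm (a n * complex_of_real r ^ n) \<le> sqrt K * r ^ n" if "n \<ge> 0" for n
      using aK[of n] \<open>0 < r\<close> by (simp add: norm_mult norm_power mult_right_mono)
  qed
  then have "conv_radius a \<ge> 1"
    by (intro conv_radius_geI_ex') auto
  then have rad: "fps_conv_radius (Abs_fps a) \<ge> 1"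
    by (simp add: fps_conv_radius_def)
  define f where "f = on_disc (eval_fps (Abs_fps a))"
  have "ball 0 1 \<subseteq> eball (0::complex) (fps_conv_radius (Abs_fps a))"
    using rad by (auto simp: eball_def intro: less_le_trans[of "ereal _" 1])
  then have hol: "f holomorphic_on ball 0 1"
    unfolding f_def by (intro on_disc_holomorphic holomorphic_on_eval_fps)
  have "f has_fps_expansion Abs_fps a"
    unfolding f_def using rad
    by (intro has_fps_expansion_on_disc eval_fps_has_fps_expansion) (auto intro: less_le_trans[of 0 1])
  then have co: "taylor_coeff f n = a n" for n
    by (simp add: taylor_coeff_eqI)
  show thesis
  proof (rule that)
    show "f \<in> hardy2"
      using hol co assms by (auto simp: hardy2_def f_def on_disc_def)
  qed (rule co)
qed

lemma taylor_coeff_add: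
  assumes "f \<in> hardy2" "g \<in> hardy2"
  shows "taylor_coeff (f + g) n = taylor_coeff f n + taylor_coeff g n"
  using taylor_coeff_eqI[OF has_fps_expansion_add[OF assms[THEN hardy2_has_fps_expansion]]]
  by (simp add: taylor_coeff_def plus_fun_def)

lemma taylor_coeff_diff:
  assumes "f \<in> hardy2" "g \<in> hardy2"
  shows "taylor_coeff (f - g) n = taylor_coeff f n - taylor_coeff g n"
  using taylor_coeff_eqI[OF has_fps_expansion_diff[OF assms[THEN hardy2_has_fps_expansion]]]
  by (simp add: taylor_coeff_def fun_diff_def)

lemma taylor_coeff_cmult:
  assumes "f \<in> hardy2"
  shows "taylor_coeff (\<lambda>z. c * f z) n = c * taylor_coeff f n"
  using taylor_coeff_eqI[OF has_fps_expansion_cmult_left[OF hardy2_has_fps_expansion[OF assms]]]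
  by (simp add: taylor_coeff_def)

lemma taylor_coeff_mult_z:
  assumes "f \<in> hardy2"
  shows "taylor_coeff (mult_z f) n = (if n = 0 then 0 else taylor_coeff f (n - 1))"
  using taylor_coeff_eqI[OF has_fps_expansion_mult[OF has_fps_expansion_fps_X
      hardy2_has_fps_expansion[OF assms]]]
  by (simp add: taylor_coeff_def mult_z_def)

lemma summable_norm_add_power2:
  fixes a b :: "nat \<Rightarrow> 'a::real_normed_vector"
  assumes "summable (\<lambda>n. (norm (a n))\<^sup>2)" "summable (\<lambda>n. (norm (b n))\<^sup>2)"
  shows "summable (\<lambda>n. (norm (a n + b n))\<^sup>2)"
proof (rule summable_comparison_test')
  show "summable (\<lambda>n. 2 * ((norm (a n))\<^sup>2 + (norm (b n))\<^sup>2))"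
    using assms by (intro summable_mult summable_add)
  fix n
  have "(norm (a n + b n))\<^sup>2 \<le> (norm (a n) + norm (b n))\<^sup>2"
    by (intro power_mono norm_triangle_ineq) auto
  also have "\<dots> \<le> 2 * ((norm (a n))\<^sup>2 + (norm (b n))\<^sup>2)"
    using sum_squares_bound[of "norm (a n)" "norm (b n)"] by (simp add: power2_sum)
  finally show "norm ((norm (a n + b n))\<^sup>2) \<le> 2 * ((norm (a n))\<^sup>2 + (norm (b n))\<^sup>2)"
    by simp
qed

lemma hardy2_add:
  assumes "f \<in> hardy2" "g \<in> hardy2"
  shows "f + g \<in> hardy2"
  using assms summable_norm_add_power2[OF assms[THEN hardy2_summable]]
  by (auto simp: hardy2_def taylor_coeff_add[OF assms, unfolded plus_fun_def] plus_fun_def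
      intro!: holomorphic_intros)

lemma hardy2_cmult:
  assumes "f \<in> hardy2"
  shows "(\<lambda>z. c * f z) \<in> hardy2"
  using assms
  by (auto simp: hardy2_def taylor_coeff_cmult[OF assms] norm_mult power_mult_distrib
      intro!: holomorphic_intros summable_mult)

lemma hardy2_diff:
  assumes "f \<in> hardy2" "g \<in> hardy2"
  shows "f - g \<in> hardy2"
  using hardy2_add[OF assms(1) hardy2_cmult[OF assms(2), of "-1"]]
  by (simp add: plus_fun_def fun_diff_def)

lemma hardy2_mult_z:
  assumes "f \<in> hardy2"
  shows "mult_z f \<in> hardy2"
proof -
  have "summable (\<lambda>n. (norm (taylor_coeff (mult_z f) (n + 1)))\<^sup>2)"
    using hardy2_summable[OF assms] by (simp add: taylor_coeff_mult_z[OF assms])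
  then have "summable (\<lambda>n. (norm (taylor_coeff (mult_z f) n))\<^sup>2)"
    by (subst (asm) summable_iff_shift)
  then show ?thesis
    using assms by (auto simp: hardy2_def mult_z_def intro!: holomorphic_intros)
qed

lemma hardy2_on_disc_affine:
  "on_disc (\<lambda>z. \<alpha> + \<beta> * z) \<in> hardy2"
  "taylor_coeff (on_disc (\<lambda>z. \<alpha> + \<beta> * z)) n = (if n = 0 then \<alpha> else if n = 1 then \<beta> else 0)"
proof -
  let ?f = "on_disc (\<lambda>z. \<alpha> + \<beta> * z)"
  have "?f has_fps_expansion fps_const \<alpha> + fps_const \<beta> * fps_X"
    by (intro has_fps_expansion_on_disc fps_expansion_intros)
  then have co: "taylor_coeff ?f n = (if n = 0 then \<alpha> else if n = 1 then \<beta> else 0)" for n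
    by (simp add: taylor_coeff_eqI fps_X_def)
  have "?f holomorphic_on ball 0 1"
    by (intro on_disc_holomorphic holomorphic_intros)
  moreover have "summable (\<lambda>n. (norm (taylor_coeff ?f n))\<^sup>2)"
    by (rule summable_finite[of "{0, 1}"]) (auto simp: co)
  ultimately show "?f \<in> hardy2"
    by (auto simp: hardy2_def on_disc_def)
  show "taylor_coeff ?f n = (if n = 0 then \<alpha> else if n = 1 then \<beta> else 0)"
    by (rule co)
qed

lemma hardy2_on_disc_power:
  "on_disc (\<lambda>z. z ^ k) \<in> hardy2"
  "taylor_coeff (on_disc (\<lambda>z. z ^ k)) n = (if n = k then 1 else 0)"
proof -
  let ?f = "on_disc (\<lambda>z. z ^ k)"
  have "?f has_fps_expansion fps_X ^ k"
    by (intro has_fps_expansion_on_disc fps_expansion_intros)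
  then have co: "taylor_coeff ?f n = (if n = k then 1 else 0)" for n
    by (simp add: taylor_coeff_eqI)
  have "?f holomorphic_on ball 0 1"
    by (intro on_disc_holomorphic holomorphic_intros)
  moreover have "summable (\<lambda>n. (norm (taylor_coeff ?f n))\<^sup>2)"
    by (rule summable_finite[of "{k}"]) (auto simp: co)
  ultimately show "?f \<in> hardy2"
    by (auto simp: hardy2_def on_disc_def)
  show "taylor_coeff ?f n = (if n = k then 1 else 0)"
    by (rule co)
qed

lemma hardy2_zero: "0 \<in> hardy2" and taylor_coeff_zero: "taylor_coeff 0 n = 0"
  using hardy2_cmult[OF hardy2_on_disc_power(1), of 0 0]
    taylor_coeff_cmult[OF hardy2_on_disc_power(1), of 0 0]
  by (simp_all add: zero_fun_def)

lemma hardy2_sum: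
  assumes "\<And>k. k \<in> A \<Longrightarrow> F k \<in> hardy2"
  shows "sum F A \<in> hardy2"
  using assms
proof (induction A rule: infinite_finite_induct)
  case (insert k A)
  then show ?case
    unfolding sum.insert[OF insert.hyps] by (intro hardy2_add) auto
qed (simp_all only: sum.infinite sum.empty hardy2_zero not_False_eq_True)

lemma taylor_coeff_sum:
  assumes "\<And>k. k \<in> A \<Longrightarrow> F k \<in> hardy2"
  shows "taylor_coeff (sum F A) n = (\<Sum>k\<in>A. taylor_coeff (F k) n)"
  using assms
proof (induction A rule: infinite_finite_induct)
  case (insert k A)
  then have "sum F A \<in> hardy2" "F k \<in> hardy2"
    using hardy2_sum[of A F] by auto
  then show ?case
    using insert.IH insert.prems
    unfolding sum.insert[OF insert.hyps] by (subst taylor_coeff_add) auto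
qed (simp_all only: sum.infinite sum.empty taylor_coeff_zero not_False_eq_True)

section \<open>The inner product\<close>

lemma summable_mult_cnj:
  fixes a b :: "nat \<Rightarrow> complex"
  assumes "summable (\<lambda>n. (norm (a n))\<^sup>2)" "summable (\<lambda>n. (norm (b n))\<^sup>2)"
  shows "summable (\<lambda>n. a n * cnj (b n))"
proof (rule summable_comparison_test')
  show "summable (\<lambda>n. (norm (a n))\<^sup>2 + (norm (b n))\<^sup>2)"
    using assms by (intro summable_add)
  fix n
  have "2 * (norm (a n) * norm (b n)) \<le> (norm (a n))\<^sup>2 + (norm (b n))\<^sup>2"
    using sum_squares_bound[of "norm (a n)" "norm (b n)"] by simp
  moreover have "0 \<le> norm (a n) * norm (b n)"
    by simp
  ultimately have "norm (a n) * norm (b n) \<le> (norm (a n))\<^sup>2 + (norm (b n))\<^sup>2"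
    by linarith
  then show "norm (a n * cnj (b n)) \<le> (norm (a n))\<^sup>2 + (norm (b n))\<^sup>2"
    by (simp add: norm_mult)
qed

lemma h2_inner_summable:
  assumes "f \<in> hardy2" "g \<in> hardy2"
  shows "summable (\<lambda>n. taylor_coeff f n * cnj (taylor_coeff g n))"
  using assms by (intro summable_mult_cnj hardy2_summable)

lemma h2_inner_diff_left:
  assumes "f \<in> hardy2" "g \<in> hardy2" "h \<in> hardy2"
  shows "h2_inner (f - g) h = h2_inner f h - h2_inner g h"
  using assms
  by (simp add: h2_inner_def taylor_coeff_diff left_diff_distrib suminf_diff h2_inner_summable)

lemma h2_inner_commute:
  assumes "f \<in> hardy2" "g \<in> hardy2"
  shows "h2_inner g f = cnj (h2_inner f g)"
proof -
  have "(\<lambda>n. taylor_coeff f n * cnj (taylor_coeff g n)) sums h2_inner f g"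
    unfolding h2_inner_def using assms by (intro summable_sums h2_inner_summable)
  then have "(\<lambda>n. cnj (taylor_coeff f n * cnj (taylor_coeff g n))) sums cnj (h2_inner f g)"
    by (simp only: sums_cnj)
  then show ?thesis
    by (simp add: h2_inner_def mult.commute sums_iff)
qed

lemma h2_inner_self:
  assumes "f \<in> hardy2"
  shows "h2_inner f f = of_real (\<Sum>n. (norm (taylor_coeff f n))\<^sup>2)"
  using hardy2_summable[OF assms]
  by (simp add: h2_inner_def complex_norm_square[symmetric] suminf_of_real)

lemma h2_norm_power2:
  assumes "f \<in> hardy2"
  shows "(h2_norm f)\<^sup>2 = (\<Sum>n. (norm (taylor_coeff f n))\<^sup>2)"
  using hardy2_summable[OF assms] by (simp add: h2_norm_def h2_inner_self[OF assms] suminf_nonneg)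

lemma norm_taylor_coeff_le_h2_norm:
  assumes "f \<in> hardy2"
  shows "norm (taylor_coeff f n) \<le> h2_norm f"
proof (rule power2_le_imp_le)
  show "(norm (taylor_coeff f n))\<^sup>2 \<le> (h2_norm f)\<^sup>2"
    using sum_le_suminf[OF hardy2_summable[OF assms], of "{n}"] by (simp add: h2_norm_power2[OF assms])
  show "0 \<le> h2_norm f"
    using hardy2_summable[OF assms] by (simp add: h2_norm_def h2_inner_self[OF assms] suminf_nonneg)
qed

lemma h2_inner_self_eq_0:
  assumes f: "f \<in> hardy2" and "h2_inner f f = 0"
  shows "taylor_coeff f n = 0"
  using norm_taylor_coeff_le_h2_norm[OF f, of n] assms(2) by (simp add: h2_norm_def)

text \<open>
  An element of a subspace is determined by its inner products with that subspace: the difference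
  of two candidates would be orthogonal to itself. This makes the descriptions in
  \<^const>\<open>h2_proj\<close> and \<^const>\<open>h2_adjoint_on\<close> definite.
\<close>
lemma h2_inner_eqI:
  assumes M: "M \<subseteq> hardy2" and diff: "\<And>f g. f \<in> M \<Longrightarrow> g \<in> M \<Longrightarrow> f - g \<in> M"
    and g: "g \<in> M" "g' \<in> M"
    and eq: "\<And>h. h \<in> M \<Longrightarrow> h2_inner g h = h2_inner g' h"
  shows "g = g'"
proof -
  have gh: "g \<in> hardy2" "g' \<in> hardy2" and d: "g - g' \<in> M" "g - g' \<in> hardy2"
    using M diff g by auto
  have "h2_inner (g - g') (g - g') = 0"
    using eq[OF d(1)] gh d by (simp add: h2_inner_diff_left)
  then show ?thesis
    using h2_inner_self_eq_0[OF d(2)] gh by (intro hardy2_eqI) (auto simp: taylor_coeff_diff)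
qed

lemma h2_proj_eqI:
  assumes M: "M \<subseteq> hardy2" and diff: "\<And>f g. f \<in> M \<Longrightarrow> g \<in> M \<Longrightarrow> f - g \<in> M"
    and f: "f \<in> hardy2" and g: "g \<in> M"
    and orth: "\<And>h. h \<in> M \<Longrightarrow> h2_inner f h = h2_inner g h"
  shows "h2_proj M f = g"
  unfolding h2_proj_def
proof (rule the_equality)
  have "h2_inner (f - g) h = 0" if "h \<in> M" for h
    using that M f g orth[OF that] by (subst h2_inner_diff_left) auto
  then show "g \<in> M \<and> (\<forall>h\<in>M. h2_inner (f - g) h = 0)"
    using g by blast
next
  fix g' assume g': "g' \<in> M \<and> (\<forall>h\<in>M. h2_inner (f - g') h = 0)"
  have "h2_inner g' h = h2_inner g h" if "h \<in> M" for h
  proof -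
    have "h2_inner (f - g') h = 0"
      using g' that by blast
    moreover have "h2_inner (f - g') h = h2_inner f h - h2_inner g' h"
      using that M f g' by (intro h2_inner_diff_left) auto
    ultimately show ?thesis
      using orth[OF that] by simp
  qed
  then show "g' = g"
    using g' g h2_inner_eqI[OF M diff] by blast
qed

lemma h2_adjoint_on_eqI:
  assumes M: "M \<subseteq> hardy2" and diff: "\<And>f g. f \<in> M \<Longrightarrow> g \<in> M \<Longrightarrow> f - g \<in> M"
    and h: "h \<in> M" and adj: "\<And>f. f \<in> M \<Longrightarrow> h2_inner (T f) g = h2_inner f h"
  shows "h2_adjoint_on M T g = h"
  unfolding h2_adjoint_on_def
proof (rule the_equality)
  show "h \<in> M \<and> (\<forall>f\<in>M. h2_inner (T f) g = h2_inner f h)"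
    using h adj by blast
next
  fix h' assume h': "h' \<in> M \<and> (\<forall>f\<in>M. h2_inner (T f) g = h2_inner f h')"
  have "h2_inner h' f = h2_inner h f" if "f \<in> M" for f
  proof -
    have "f \<in> hardy2" "h \<in> hardy2" "h' \<in> hardy2"
      using that M h h' by auto
    moreover have "h2_inner f h' = h2_inner f h"
      using that h' adj[OF that] by simp
    ultimately show ?thesis
      using h2_inner_commute[of f h'] h2_inner_commute[of f h] by simp
  qed
  then show "h' = h"
    using h' h h2_inner_eqI[OF M diff] by blast
qed

section \<open>The subspace in coordinates\<close>

text \<open>
  Coefficient functionals are bounded, so the closed condition
  \<open>\<beta> f\<^sub>0 = \<alpha> f\<^sub>1\<close> passes from the span to its closure. Conversely, under that condition
  a partial sum of the series is a multiple of \<open>\<alpha> + \<beta> z\<close> plus higher monomials.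
\<close>
lemma H2_ab_iff:
  assumes "\<alpha> \<noteq> 0"
  shows "f \<in> H2_ab \<alpha> \<beta> \<longleftrightarrow> f \<in> hardy2 \<and> \<beta> * taylor_coeff f 0 = \<alpha> * taylor_coeff f 1"
proof -
  let ?e = "on_disc (\<lambda>z. \<alpha> + \<beta> * z)"
  let ?B = "insert ?e {on_disc (\<lambda>z. z ^ n) |n. n \<ge> 2}"
  let ?M = "{f \<in> hardy2. \<beta> * taylor_coeff f 0 = \<alpha> * taylor_coeff f 1}"
  have "?B \<subseteq> ?M"
    by (auto simp: hardy2_on_disc_affine hardy2_on_disc_power)
  moreover have "cfun.subspace ?M"
    unfolding cfun.subspace_def
    by (auto simp: hardy2_zero taylor_coeff_zero hardy2_add hardy2_cmult taylor_coeff_add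
        taylor_coeff_cmult algebra_simps)
  ultimately have span: "cfun.span ?B \<subseteq> ?M"
    by (rule cfun.span_minimal)
  show ?thesis
  proof
    assume "f \<in> H2_ab \<alpha> \<beta>"
    then have f: "f \<in> hardy2" and appr: "\<And>e. e > 0 \<Longrightarrow> \<exists>g \<in> cfun.span ?B. h2_norm (f - g) < e"
      by (auto simp: H2_ab_def h2_closed_span_def)
    have "norm (\<beta> * taylor_coeff f 0 - \<alpha> * taylor_coeff f 1) \<le> 0 + e" if e: "e > 0" for e
    proof -
      define C where "C = norm \<alpha> + norm \<beta>"
      have C: "C > 0"
        using assms by (simp add: C_def add_pos_nonneg)
      obtain g where g: "g \<in> cfun.span ?B" "h2_norm (f - g) < e / C"
        using appr[OF divide_pos_pos[OF e C]] by blast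
      then have gM: "g \<in> hardy2" "\<beta> * taylor_coeff g 0 = \<alpha> * taylor_coeff g 1"
        using span by auto
      let ?d = "taylor_coeff (f - g)"
      have "\<beta> * taylor_coeff f 0 - \<alpha> * taylor_coeff f 1 = \<beta> * ?d 0 - \<alpha> * ?d 1"
        using gM f by (simp add: taylor_coeff_diff algebra_simps)
      also have "norm \<dots> \<le> norm \<beta> * norm (?d 0) + norm \<alpha> * norm (?d 1)"
        by (metis norm_mult norm_triangle_ineq4)
      also have "\<dots> \<le> norm \<beta> * h2_norm (f - g) + norm \<alpha> * h2_norm (f - g)"
        using f gM by (intro add_mono mult_left_mono norm_taylor_coeff_le_h2_norm hardy2_diff) auto
      also have "\<dots> = C * h2_norm (f - g)"
        by (simp add: C_def algebra_simps)
      also have "\<dots> \<le> e"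
        using g(2) C by (simp add: field_simps)
      finally show ?thesis
        by simp
    qed
    then have "norm (\<beta> * taylor_coeff f 0 - \<alpha> * taylor_coeff f 1) \<le> 0"
      by (rule field_le_epsilon)
    then show "f \<in> hardy2 \<and> \<beta> * taylor_coeff f 0 = \<alpha> * taylor_coeff f 1"
      using f by simp
  next
    assume "f \<in> hardy2 \<and> \<beta> * taylor_coeff f 0 = \<alpha> * taylor_coeff f 1"
    then have f: "f \<in> hardy2" and f01: "\<beta> * taylor_coeff f 0 = \<alpha> * taylor_coeff f 1"
      by auto
    \<comment> \<open>the factor \<open>f\<^sub>0 / \<alpha>\<close> matches \<open>f\<close> in degree zero, and the linear condition then gives degree one\<close>
    let ?p = "\<lambda>N. (\<lambda>z. (taylor_coeff f 0 / \<alpha>) * ?e z) +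
                    (\<Sum>k\<in>{2..<N}. (\<lambda>z. taylor_coeff f k * on_disc (\<lambda>z. z ^ k) z))"
    have p_span: "?p N \<in> cfun.span ?B" for N
      by (intro cfun.span_add cfun.span_sum cfun.span_scale cfun.span_base) auto
    let ?s = "\<lambda>A. \<Sum>k\<in>A. (\<lambda>z. taylor_coeff f k * on_disc (\<lambda>z. z ^ k) z)"
    have sum_in: "?s A \<in> hardy2" for A
      by (intro hardy2_sum hardy2_cmult hardy2_on_disc_power)
    have sum_coeff: "taylor_coeff (?s A) n = (if n \<in> A then taylor_coeff f n else 0)"
      if "finite A" for A n
      using that by (subst taylor_coeff_sum)
        (auto simp: taylor_coeff_cmult hardy2_cmult hardy2_on_disc_power if_distrib cong: if_cong)
    have p_coeff: "taylor_coeff (?p N) n = (if n < N then taylor_coeff f n else 0)"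
      if "N \<ge> 2" for N n
    proof -
      have "taylor_coeff (?p N) n = (taylor_coeff f 0 / \<alpha>) * taylor_coeff ?e n
          + (if n \<in> {2..<N} then taylor_coeff f n else 0)"
        by (simp only: taylor_coeff_add[OF hardy2_cmult[OF hardy2_on_disc_affine(1)] sum_in]
            taylor_coeff_cmult[OF hardy2_on_disc_affine(1)] sum_coeff finite_atLeastLessThan)
      moreover have "taylor_coeff f 0 / \<alpha> * \<beta> = taylor_coeff f 1"
        using f01 assms by (simp add: field_simps)
      ultimately show ?thesis
        using that assms
        by (cases "n = 0"; cases "n = 1") (auto simp: hardy2_on_disc_affine)
    qed
    have "\<exists>g\<in>cfun.span ?B. h2_norm (f - g) < e" if e: "e > 0" for e
    proof -
      obtain N0 where N0: "\<And>n. n \<ge> N0 \<Longrightarrow>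
          norm (\<Sum>i. (norm (taylor_coeff f (i + n)))\<^sup>2) < e\<^sup>2"
        using suminf_exist_split[OF zero_less_power[OF e] hardy2_summable[OF f]] by blast
      define N where "N = max N0 2"
      have N: "N \<ge> 2" "N \<ge> N0"
        by (auto simp: N_def)
      obtain p where p_in: "p \<in> cfun.span ?B"
        and p_co: "\<And>n. taylor_coeff p n = (if n < N then taylor_coeff f n else 0)"
        using p_span p_coeff[OF N(1)] by blast
      have p: "p \<in> hardy2"
        using p_in span by blast
      have d: "f - p \<in> hardy2"
        using f p by (rule hardy2_diff)
      have co: "taylor_coeff (f - p) n = (if n < N then 0 else taylor_coeff f n)" for n
        by (simp add: taylor_coeff_diff[OF f p] p_co)
      have "(h2_norm (f - p))\<^sup>2 = (\<Sum>i. (norm (taylor_coeff f (i + N)))\<^sup>2)"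
        using suminf_split_initial_segment[OF hardy2_summable[OF d], of N]
        by (simp add: h2_norm_power2[OF d] co)
      also have "\<dots> < e\<^sup>2"
        using N0[OF N(2)] by (simp add: abs_less_iff)
      finally have "h2_norm (f - p) < e"
        using e by (intro power_less_imp_less_base[of _ 2 e]) auto
      then show ?thesis
        using p_in by blast
    qed
    then show "f \<in> H2_ab \<alpha> \<beta>"
      using f by (auto simp: H2_ab_def h2_closed_span_def)
  qed
qed

context
  fixes \<alpha> \<beta> :: complex
  assumes \<alpha>0: "\<alpha> \<noteq> 0" and unit: "(norm \<alpha>)\<^sup>2 + (norm \<beta>)\<^sup>2 = 1"
begin

text \<open>The coordinate of \<open>f\<close> along the unit vector \<open>\<alpha> + \<beta> z\<close>.\<close>
definition coord :: "(complex \<Rightarrow> complex) \<Rightarrow> complex" where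
  "coord f = cnj \<alpha> * taylor_coeff f 0 + cnj \<beta> * taylor_coeff f 1"

lemma unit_cnj: "\<alpha> * cnj \<alpha> + \<beta> * cnj \<beta> = 1"
  using arg_cong[OF unit, of complex_of_real] by (simp add: complex_norm_square del: of_real_power)

lemma coord_eqI:
  assumes "taylor_coeff f 0 = a * \<alpha>" "taylor_coeff f 1 = a * \<beta>"
  shows "coord f = a"
proof -
  have "coord f = a * (\<alpha> * cnj \<alpha> + \<beta> * cnj \<beta>)"
    unfolding coord_def assms by (simp add: algebra_simps)
  then show ?thesis
    by (simp add: unit_cnj)
qed

lemma H2_ab_subset: "H2_ab \<alpha> \<beta> \<subseteq> hardy2"
  using H2_ab_iff[OF \<alpha>0] by blast

lemma H2_ab_diff: "f \<in> H2_ab \<alpha> \<beta> \<Longrightarrow> g \<in> H2_ab \<alpha> \<beta> \<Longrightarrow> f - g \<in> H2_ab \<alpha> \<beta>"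
  by (auto simp: H2_ab_iff[OF \<alpha>0] hardy2_diff taylor_coeff_diff algebra_simps)

lemma H2_ab_coeffs:
  assumes "f \<in> H2_ab \<alpha> \<beta>"
  shows "taylor_coeff f 0 = coord f * \<alpha>" "taylor_coeff f 1 = coord f * \<beta>"
proof -
  have eq: "\<beta> * taylor_coeff f 0 = \<alpha> * taylor_coeff f 1"
    using assms H2_ab_iff[OF \<alpha>0] by blast
  have "coord f * \<alpha> = \<alpha> * cnj \<alpha> * taylor_coeff f 0 + cnj \<beta> * (\<alpha> * taylor_coeff f 1)"
    by (simp add: coord_def algebra_simps)
  also have "\<dots> = (\<alpha> * cnj \<alpha> + \<beta> * cnj \<beta>) * taylor_coeff f 0"
    unfolding eq[symmetric] by (simp add: algebra_simps)
  finally show *: "taylor_coeff f 0 = coord f * \<alpha>"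
    by (simp add: unit_cnj)
  show "taylor_coeff f 1 = coord f * \<beta>"
    using eq \<alpha>0 unfolding * by (simp add: mult.commute)
qed

lemma H2_ab_of_coords:
  assumes "summable (\<lambda>n. (norm (b n))\<^sup>2)"
  obtains f where "f \<in> H2_ab \<alpha> \<beta>" and "coord f = a" and "\<And>n. taylor_coeff f (n + 2) = b n"
proof -
  define s where "s = (\<lambda>n. if n = 0 then a * \<alpha> else if n = 1 then a * \<beta> else b (n - 2))"
  have "summable (\<lambda>n. (norm (s (n + 2)))\<^sup>2)"
    using assms by (simp add: s_def)
  then have "summable (\<lambda>n. (norm (s n))\<^sup>2)"
    by (subst (asm) summable_iff_shift)
  then obtain f where f: "f \<in> hardy2" "\<And>n. taylor_coeff f n = s n"
    using hardy2_of_coeffs by blast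
  show thesis
  proof (rule that)
    show "f \<in> H2_ab \<alpha> \<beta>"
      using f by (simp add: H2_ab_iff[OF \<alpha>0] s_def)
    show "coord f = a"
      by (rule coord_eqI) (simp_all add: f s_def)
    show "taylor_coeff f (n + 2) = b n" for n
      by (simp add: f s_def)
  qed
qed

text \<open>
  Against a multiple of \<open>\<alpha> + \<beta> z\<close>, the first two coefficients of \<open>f\<close> enter through the
  coordinate alone. The formula thus also applies to products \<open>z f\<close>, which in general lie outside
  the subspace.
\<close>
lemma h2_inner_coord:
  assumes f: "f \<in> hardy2" and g: "g \<in> H2_ab \<alpha> \<beta>"
  shows "h2_inner f g = coord f * cnj (coord g)
           + (\<Sum>n. taylor_coeff f (n + 2) * cnj (taylor_coeff g (n + 2)))"
proof -
  have "h2_inner f g = (\<Sum>n. taylor_coeff f (n + 2) * cnj (taylor_coeff g (n + 2)))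
      + (taylor_coeff f 0 * cnj (taylor_coeff g 0) + taylor_coeff f 1 * cnj (taylor_coeff g 1))"
    unfolding h2_inner_def
    using suminf_split_initial_segment[OF h2_inner_summable[OF f], of g 2] g H2_ab_subset
    by (auto simp: numeral_2_eq_2)
  then show ?thesis
    unfolding H2_ab_coeffs[OF g] by (simp add: coord_def algebra_simps)
qed

lemma H2_ab_tail_summable:
  assumes "f \<in> H2_ab \<alpha> \<beta>"
  shows "summable (\<lambda>n. (norm (taylor_coeff f (n + k)))\<^sup>2)"
  using assms H2_ab_subset hardy2_summable by (subst summable_iff_shift) blast

lemma h2_inner_self_coord:
  assumes f: "f \<in> H2_ab \<alpha> \<beta>"
  shows "h2_inner f f = of_real ((norm (coord f))\<^sup>2 + (\<Sum>n. (norm (taylor_coeff f (n + 2)))\<^sup>2))"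
  using h2_inner_coord[OF _ f, of f] f H2_ab_subset H2_ab_tail_summable[OF f, of 2]
  by (simp add: subset_iff complex_norm_square[symmetric] suminf_of_real)

section \<open>The compressed shift and its adjoint\<close>

text \<open>
  The coordinate of \<open>z f\<close> along \<open>\<alpha> + \<beta> z\<close> comes only from its linear coefficient \<open>f\<^sub>0\<close>,
  because \<open>z f\<close> vanishes at the origin; its part of degree at least two already lies in the
  subspace.
\<close>
lemma S_ab_coords:
  assumes f: "f \<in> H2_ab \<alpha> \<beta>"
  shows "S_ab \<alpha> \<beta> f \<in> H2_ab \<alpha> \<beta>"
    and "coord (S_ab \<alpha> \<beta> f) = \<alpha> * cnj \<beta> * coord f"
    and "taylor_coeff (S_ab \<alpha> \<beta> f) (n + 2) = taylor_coeff f (n + 1)"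
proof -
  have fh: "f \<in> hardy2"
    using f H2_ab_subset by blast
  obtain g where g: "g \<in> H2_ab \<alpha> \<beta>" "coord g = \<alpha> * cnj \<beta> * coord f"
    "\<And>n. taylor_coeff g (n + 2) = taylor_coeff f (n + 1)"
    using H2_ab_of_coords[OF H2_ab_tail_summable[OF f, of 1]] by metis
  have "coord (mult_z f) = coord g"
    using H2_ab_coeffs[OF f] by (simp add: coord_def[of "mult_z f"] taylor_coeff_mult_z[OF fh] g(2))
  then have "h2_inner (mult_z f) h = h2_inner g h" if "h \<in> H2_ab \<alpha> \<beta>" for h
    using that g H2_ab_subset hardy2_mult_z[OF fh]
    by (subst (1 2) h2_inner_coord) (auto simp: taylor_coeff_mult_z[OF fh])
  then have "S_ab \<alpha> \<beta> f = g"
    unfolding S_ab_def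
    using H2_ab_subset H2_ab_diff hardy2_mult_z[OF fh] g(1) by (intro h2_proj_eqI)
  then show "S_ab \<alpha> \<beta> f \<in> H2_ab \<alpha> \<beta>" "coord (S_ab \<alpha> \<beta> f) = \<alpha> * cnj \<beta> * coord f"
    "taylor_coeff (S_ab \<alpha> \<beta> f) (n + 2) = taylor_coeff f (n + 1)"
    using g by auto
qed

text \<open>
  The matrix of \<^term>\<open>S_ab \<alpha> \<beta>\<close> is transposed and conjugated: the coefficient \<open>g\<^sub>2\<close> returns to the
  first coordinate, because \<open>f\<^sub>1\<close>, which \<open>S\<close> moves to degree two, is \<open>\<beta>\<close> times the first
  coordinate of \<open>f\<close>.
\<close>
lemma S_ab_adjoint_coords:
  fixes g :: "complex \<Rightarrow> complex"
  defines "h \<equiv> h2_adjoint_on (H2_ab \<alpha> \<beta>) (S_ab \<alpha> \<beta>) g"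
  assumes g: "g \<in> H2_ab \<alpha> \<beta>"
  shows "h \<in> H2_ab \<alpha> \<beta>"
    and "coord h = cnj \<alpha> * \<beta> * coord g + cnj \<beta> * taylor_coeff g 2"
    and "taylor_coeff h (n + 2) = taylor_coeff g (n + 3)"
    and "f \<in> H2_ab \<alpha> \<beta> \<Longrightarrow> h2_inner (S_ab \<alpha> \<beta> f) g = h2_inner f h"
proof -
  obtain k where k: "k \<in> H2_ab \<alpha> \<beta>"
    "coord k = cnj \<alpha> * \<beta> * coord g + cnj \<beta> * taylor_coeff g 2"
    "\<And>n. taylor_coeff k (n + 2) = taylor_coeff g (n + 3)"
    using H2_ab_of_coords[OF H2_ab_tail_summable[OF g, of 3]] by metis
  have adj: "h2_inner (S_ab \<alpha> \<beta> f) g = h2_inner f k" if f: "f \<in> H2_ab \<alpha> \<beta>" for f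
  proof -
    let ?t = "\<lambda>n. taylor_coeff f (n + 1) * cnj (taylor_coeff g (n + 2))"
    have fh: "f \<in> hardy2" and Sh: "S_ab \<alpha> \<beta> f \<in> hardy2"
      using f S_ab_coords(1)[OF f] H2_ab_subset by auto
    have t: "summable ?t"
      by (intro summable_mult_cnj H2_ab_tail_summable f g)
    have "h2_inner (S_ab \<alpha> \<beta> f) g = \<alpha> * cnj \<beta> * coord f * cnj (coord g) + suminf ?t"
      by (simp add: h2_inner_coord[OF Sh g] S_ab_coords(2,3)[OF f] del: add_2_eq_Suc')
    also have "suminf ?t = (\<Sum>n. ?t (n + 1)) + coord f * \<beta> * cnj (taylor_coeff g 2)"
      using suminf_split_initial_segment[OF t, of 1] H2_ab_coeffs(2)[OF f]
      by (simp add: numeral_2_eq_2)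
    also have "(\<Sum>n. ?t (n + 1)) = (\<Sum>n. taylor_coeff f (n + 2) * cnj (taylor_coeff k (n + 2)))"
      unfolding k(3) by (simp add: numeral_2_eq_2 numeral_3_eq_3)
    finally show ?thesis
      unfolding h2_inner_coord[OF fh k(1)] k(2) by (simp add: algebra_simps)
  qed
  have "h = k"
    unfolding h_def using H2_ab_subset H2_ab_diff k(1) adj by (intro h2_adjoint_on_eqI)
  then show "h \<in> H2_ab \<alpha> \<beta>" "coord h = cnj \<alpha> * \<beta> * coord g + cnj \<beta> * taylor_coeff g 2"
    "taylor_coeff h (n + 2) = taylor_coeff g (n + 3)"
    "f \<in> H2_ab \<alpha> \<beta> \<Longrightarrow> h2_inner (S_ab \<alpha> \<beta> f) g = h2_inner f h"
    using k adj by auto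
qed

text \<open>
  Only the moduli matter after the triangle inequality. The right-hand side has a full \<open>|b|\<^sup>2\<close>,
  of which the share \<open>|\<alpha>|\<^sup>2 |b|\<^sup>2\<close> survives the subtraction; it completes the square with
  \<open>|\<beta> a|\<^sup>2\<close>, and the cross term left over is nonnegative since \<open>|\<beta>| \<le> 1\<close>.
\<close>
lemma self_commutator_form_nonneg:
  fixes a b :: complex
  shows "(norm (cnj \<alpha> * \<beta> * a + cnj \<beta> * b))\<^sup>2
           \<le> (norm (\<alpha> * cnj \<beta> * a))\<^sup>2 + (norm (a * \<beta>))\<^sup>2 + (norm b)\<^sup>2"
proof -
  define s t x y where "s = norm \<alpha>" and "t = norm \<beta>" and "x = norm a" and "y = norm b"
  have nn: "0 \<le> s" "0 \<le> t" "0 \<le> x" "0 \<le> y" and st: "s\<^sup>2 + t\<^sup>2 = 1"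
    using unit by (simp_all add: s_def t_def x_def y_def)
  have t1: "t \<le> 1"
  proof (rule power2_le_imp_le)
    show "t\<^sup>2 \<le> 1\<^sup>2"
      using st zero_le_power2[of s] unfolding one_power2 by linarith
  qed simp
  have y2: "y\<^sup>2 = s\<^sup>2 * y\<^sup>2 + t\<^sup>2 * y\<^sup>2"
    by (simp only: st distrib_right[symmetric] mult_1)
  have "norm (cnj \<alpha> * \<beta> * a + cnj \<beta> * b) \<le> s * t * x + t * y"
    using norm_triangle_ineq[of "cnj \<alpha> * \<beta> * a" "cnj \<beta> * b"]
    by (simp add: norm_mult s_def t_def x_def y_def)
  then have "(norm (cnj \<alpha> * \<beta> * a + cnj \<beta> * b))\<^sup>2 \<le> (s * t * x + t * y)\<^sup>2"
    by (intro power_mono) auto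
  also have "\<dots> \<le> (s * t * x)\<^sup>2 + (x * t)\<^sup>2 + y\<^sup>2"
  proof -
    have "(s * t * x)\<^sup>2 + (x * t)\<^sup>2 + y\<^sup>2 - (s * t * x + t * y)\<^sup>2
        = (t * x - s * y)\<^sup>2 + 2 * (t * x * (s * y) * (1 - t))"
      by (subst y2) (simp add: power2_eq_square algebra_simps)
    moreover have "0 \<le> t * x * (s * y) * (1 - t)"
      using nn t1 by (intro mult_nonneg_nonneg) auto
    ultimately show ?thesis
      using zero_le_power2[of "t * x - s * y"] by linarith
  qed
  finally show ?thesis
    by (simp add: norm_mult s_def t_def x_def y_def)
qed

lemma S_ab_hyponormal: "h2_hyponormal_on (H2_ab \<alpha> \<beta>) (S_ab \<alpha> \<beta>)"
  unfolding h2_hyponormal_on_def h2_positive_on_def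
proof
  fix f assume f: "f \<in> H2_ab \<alpha> \<beta>"
  let ?S = "S_ab \<alpha> \<beta>" and ?A = "h2_adjoint_on (H2_ab \<alpha> \<beta>) (S_ab \<alpha> \<beta>)"
  note mem = S_ab_coords(1) S_ab_adjoint_coords(1) f subsetD[OF H2_ab_subset]
  define r where "r = (\<Sum>n. (norm (taylor_coeff f (n + 3)))\<^sup>2)"
  have "h2_inner (?A (?S f)) f = cnj (h2_inner (?S f) (?S f))"
    using S_ab_adjoint_coords(4)[of "?S f" f] h2_inner_commute[of f "?A (?S f)"] mem by auto
  moreover have "h2_inner (?S (?A f)) f = h2_inner (?A f) (?A f)"
    using S_ab_adjoint_coords(4)[of f "?A f"] mem by auto
  ultimately have eq: "h2_inner (?A (?S f) - ?S (?A f)) f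
      = cnj (h2_inner (?S f) (?S f)) - h2_inner (?A f) (?A f)"
    using mem by (simp add: h2_inner_diff_left)
  have tail: "(\<Sum>n. (norm (taylor_coeff f (n + 1)))\<^sup>2)
      = (norm (coord f * \<beta>))\<^sup>2 + (norm (taylor_coeff f 2))\<^sup>2 + r"
    using suminf_split_initial_segment[OF H2_ab_tail_summable[OF f, of 1], of 2] H2_ab_coeffs(2)[OF f]
    by (simp add: r_def numeral_2_eq_2 numeral_3_eq_3)
  have S: "h2_inner (?S f) (?S f) = of_real ((norm (\<alpha> * cnj \<beta> * coord f))\<^sup>2
      + ((norm (coord f * \<beta>))\<^sup>2 + (norm (taylor_coeff f 2))\<^sup>2 + r))"
    unfolding h2_inner_self_coord[OF S_ab_coords(1)[OF f]] S_ab_coords(2,3)[OF f] tail ..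
  have A: "h2_inner (?A f) (?A f) = of_real ((norm (cnj \<alpha> * \<beta> * coord f
      + cnj \<beta> * taylor_coeff f 2))\<^sup>2 + r)"
    unfolding h2_inner_self_coord[OF S_ab_adjoint_coords(1)[OF f]] S_ab_adjoint_coords(2,3)[OF f]
      r_def ..
  show "h2_inner (?A (?S f) - ?S (?A f)) f \<in> \<real>\<^sub>\<ge>\<^sub>0"
    unfolding eq S A complex_cnj_complex_of_real of_real_diff[symmetric] nonneg_Reals_of_real_iff
    using self_commutator_form_nonneg[of "coord f" "taylor_coeff f 2"] by simp
qed

end

theorem mainTheorem3:
  fixes \<alpha> \<beta> :: complex
  assumes "\<alpha> \<noteq> 0" and "\<beta> \<noteq> 0"
    and "(norm \<alpha>)\<^sup>2 + (norm \<beta>)\<^sup>2 = 1"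
  shows "h2_hyponormal_on (H2_ab \<alpha> \<beta>) (S_ab \<alpha> \<beta>)"
  using assms(1,3) by (rule S_ab_hyponormal)

end
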